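(* Every discrete stable distribution $\mathcal{DS}(\alpha,\gamma,\delta)$ is discretely infinitely divisible: for all $\alpha\in(0,2]$ and all admissible $(\gamma,\delta)$ for $\alpha$, if $G$ denotes the probability generating function of $\mathcal{DS}(\alpha,\gamma,\delta)$, then for every $n\in\mathbb{N}$ there exists a probability generating function $H_n$ such that $G(z)=H_n(z)^n$.
   Context: A probability generating function (PGF) is a function of the form $z\mapsto\mathbb{E}[z^X]$ for a random variable $X$ with values in $\mathbb{N}_0=\{0,1,2,\ldots\}$. Here $\mathbb{N}=\{1,2,\ldots\}$. Convention: $0\log0=0$. $\mathcal{DS}(\alpha,\gamma,\delta)$, for $\alpha\in(0,2]$, is the distribution on $\mathbb{N}_0$ with PGF \[ G(z)=\begin{cases}\exp\left((z-1)\delta+\gamma(1-z)^\alpha\right) & \alpha\neq 1,\\ \exp\left((z-1)\delta+\gamma(1-z)\log(1-z)\right) & \alpha=1,\end{cases} \] where $(\gamma,\delta)\in\mathbb{R}^2$ is admissible for $\alpha$, meaning: $\gamma<0$ if $\alpha\in(0,1)$, $\gamma\ge0$ if $\alpha=1$, $\gamma>0$ if $\alpha\in(1,2]$, and $\delta\ge\alpha\gamma$. These are the paper's (broadly) discrete stable distributions. *)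

theory Defs
  imports "HOL-Probability.Probability"
begin

text \<open>
  A law on the nonnegative integers is a \<^typ>\<open>nat pmf\<close>. Its generating function is considered on
  the closed complex unit disc, where the expectation always exists; outside the disc the Bochner
  integral may take a meaningless default value, so equations between generating functions are
  only ever stated on the disc.
\<close>

definition pgf :: "nat pmf \<Rightarrow> complex \<Rightarrow> complex" where
  "pgf p z = measure_pmf.expectation p (\<lambda>k. z ^ k)"

definition is_pgf :: "(complex \<Rightarrow> complex) \<Rightarrow> bool" where
  "is_pgf H \<longleftrightarrow> (\<exists>p. \<forall>z. norm z \<le> 1 \<longrightarrow> H z = pgf p z)"

definition ds_admissible :: "real \<Rightarrow> real \<Rightarrow> real \<Rightarrow> bool" where
  "ds_admissible \<alpha> \<gamma> \<delta> \<longleftrightarrow>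
     (0 < \<alpha> \<and> \<alpha> < 1 \<longrightarrow> \<gamma> < 0) \<and>
     (\<alpha> = 1 \<longrightarrow> \<gamma> \<ge> 0) \<and>
     (1 < \<alpha> \<and> \<alpha> \<le> 2 \<longrightarrow> \<gamma> > 0) \<and>
     \<delta> \<ge> \<alpha> * \<gamma>"

text \<open>
  Powers and logarithms are principal branches, which is harmless since \<open>Re (1 - z) \<ge> 0\<close> on the
  disc. At \<open>z = 1\<close> both \<open>(1 - z) powr \<alpha>\<close> and \<open>(1 - z) * ln (1 - z)\<close> are \<open>0\<close>, as intended.
\<close>

definition ds_pgf :: "real \<Rightarrow> real \<Rightarrow> real \<Rightarrow> complex \<Rightarrow> complex" where
  "ds_pgf \<alpha> \<gamma> \<delta> z =
     (if \<alpha> \<noteq> 1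
      then exp ((z - 1) * of_real \<delta> + of_real \<gamma> * (1 - z) powr of_real \<alpha>)
      else exp ((z - 1) * of_real \<delta> + of_real \<gamma> * (1 - z) * ln (1 - z)))"

definition discrete_stable :: "real \<Rightarrow> real \<Rightarrow> real \<Rightarrow> nat pmf \<Rightarrow> bool" where
  "discrete_stable \<alpha> \<gamma> \<delta> p \<longleftrightarrow> (\<forall>z. norm z \<le> 1 \<longrightarrow> pgf p z = ds_pgf \<alpha> \<gamma> \<delta> z)"

definition discretely_infinitely_divisible :: "nat pmf \<Rightarrow> bool" where
  "discretely_infinitely_divisible p \<longleftrightarrow>
     (\<forall>n::nat. n \<ge> 1 \<longrightarrow>
        (\<exists>H. is_pgf H \<and> (\<forall>z. norm z \<le> 1 \<longrightarrow> pgf p z = H z ^ n)))"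

end

theory Submission
  imports Defs
begin

text \<open>
  Write the generating function of \<open>\<D>\<S>(\<alpha>, \<gamma>, \<delta>)\<close> as \<open>exp (f z)\<close>. The exponent is linear in
  \<open>(\<gamma>, \<delta>)\<close>, and dividing an admissible pair by \<open>n\<close> leaves it admissible. So the \<open>n\<close>-th root
  \<open>exp (f z / n)\<close> is again a discrete stable generating function, and everything reduces to the
  existence of \<open>\<D>\<S>(\<alpha>, \<gamma>, \<delta>)\<close> for all admissible parameters.

  For existence, expand \<open>f z = (\<Sum>k. c k * z ^ k)\<close> inside the disc by the binomial or the
  logarithmic series. Admissibility ensures that every coefficient other than \<open>c 0\<close> is nonnegative:
  \<open>c 1\<close> is \<open>\<delta> - \<alpha> * \<gamma>\<close>, and for \<open>k \<ge> 2\<close> the coefficient is \<open>\<gamma>\<close> times a number that is nonpositive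
  if \<open>\<alpha> < 1\<close> and nonnegative if \<open>\<alpha> \<ge> 1\<close>. Since moreover \<open>f 1 = 0\<close>, the coefficients of positive
  index add up to \<open>l = - c 0\<close>. If \<open>l = 0\<close>, then \<open>f\<close> vanishes. Otherwise \<open>f z = l * (Q z - 1)\<close>
  for the generating function \<open>Q\<close> of the law with weights \<open>c k / l\<close> for \<open>k \<ge> 1\<close>, and \<open>exp (f z)\<close> is
  the generating function of a compound Poisson law: the sum of a Poisson number, with mean \<open>l\<close>, of
  independent variables with generating function \<open>Q\<close>
  (\<open>compound_poisson_pgf\<close>, \<open>exp_power_series_is_pgf\<close>).

  The series are known only in the open disc, while the identity is wanted on the closed one. The
  nonnegativity of the coefficients together with the continuity of \<open>f\<close> up to the boundary closes
  this gap (\<open>sums_on_closed_disc\<close>).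
\<close>

section \<open>Generating functions of laws on the naturals\<close>

lemma integrable_power_pmf:
  assumes "norm (z :: complex) \<le> 1"
  shows "integrable (measure_pmf p) (\<lambda>k. z ^ k)"
  by (rule measure_pmf.integrable_const_bound[where B = 1])
     (auto simp: norm_power power_le_one assms)

lemma pgf_sums:
  assumes "norm z \<le> 1"
  shows "(\<lambda>k. of_real (pmf p k) * z ^ k) sums pgf p z"
proof -
  have "integrable (count_space UNIV) (\<lambda>k. pmf p k *\<^sub>R z ^ k)"
    using integrable_power_pmf[OF assms, of p]
    by (simp add: measure_pmf_eq_density integrable_density)
  moreover have "pgf p z = integral\<^sup>L (count_space UNIV) (\<lambda>k. pmf p k *\<^sub>R z ^ k)"
    by (simp add: pgf_def measure_pmf_eq_density integral_density)
  ultimately show ?thesis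
    using sums_integral_count_space_nat by (fastforce simp: scaleR_conv_of_real)
qed

lemma pgf_eqI:
  assumes "norm z \<le> 1" and "(\<lambda>k. of_real (pmf p k) * z ^ k) sums s"
  shows "pgf p z = s"
  using pgf_sums[OF assms(1)] assms(2) by (rule sums_unique2)

lemma norm_pgf_le_1:
  assumes "norm z \<le> 1"
  shows "norm (pgf p z) \<le> 1"
proof -
  have "norm (pgf p z) \<le> measure_pmf.expectation p (\<lambda>k. norm (z ^ k))"
    unfolding pgf_def by (rule integral_norm_bound)
  also have "\<dots> \<le> measure_pmf.expectation p (\<lambda>k. 1)"
    by (rule integral_mono)
       (auto simp: norm_power power_le_one assms intro!: measure_pmf.integrable_const_bound[where B = 1])
  finally show ?thesis by simp
qed

text \<open>
  Conditioning on the first stage of a two-stage experiment. Real and imaginary parts are treated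
  separately because \<open>integral_bind\<close> concerns real integrands.
\<close>

lemma pgf_bind:
  assumes "norm z \<le> 1"
  shows "pgf (bind_pmf p N) z = measure_pmf.expectation p (\<lambda>x. pgf (N x) z)"
proof -
  have bind: "measure_pmf.expectation (bind_pmf p N) g =
      measure_pmf.expectation p (\<lambda>x. measure_pmf.expectation (N x) g)"
    if "\<And>k. \<bar>g k\<bar> \<le> 1" for g :: "nat \<Rightarrow> real"
    unfolding measure_pmf_bind
    by (rule integral_bind[where K = "count_space UNIV" and B = 1 and B' = 1])
       (use that in \<open>auto simp: measure_pmf.emeasure_space_1
          measure_pmf.finite_measure_axioms measure_pmf_in_subprob_algebra\<close>)
  have le: "norm (pgf (N x) z) \<le> 1" for x
    using assms by (rule norm_pgf_le_1)
  have int: "integrable (measure_pmf p) (\<lambda>x. pgf (N x) z)"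
    by (rule measure_pmf.integrable_const_bound[where B = 1]) (auto simp: le)
  have pow: "\<bar>Re (z ^ k)\<bar> \<le> 1" "\<bar>Im (z ^ k)\<bar> \<le> 1" for k
    using assms abs_Re_le_cmod[of "z ^ k"] abs_Im_le_cmod[of "z ^ k"] power_le_one[of "norm z" k]
    by (auto simp: norm_power)
  show ?thesis
  proof (rule complex_eqI)
    show "Re (pgf (bind_pmf p N) z) = Re (measure_pmf.expectation p (\<lambda>x. pgf (N x) z))"
      using bind[of "\<lambda>k. Re (z ^ k)"] pow assms int
      by (simp add: pgf_def integrable_power_pmf flip: integral_Re)
    show "Im (pgf (bind_pmf p N) z) = Im (measure_pmf.expectation p (\<lambda>x. pgf (N x) z))"
      using bind[of "\<lambda>k. Im (z ^ k)"] pow assms int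
      by (simp add: pgf_def integrable_power_pmf flip: integral_Im)
  qed
qed

lemma pgf_map_add:
  "pgf (map_pmf ((+) m) p) z = z ^ m * pgf p z"
  by (simp add: pgf_def power_add)

lemma pgf_return_0: "pgf (return_pmf 0) z = 1"
  by (simp add: pgf_def)

text \<open>
  Powers arise from sums of independent copies: drawing \<open>m\<close> from \<open>q\<close> and shifting an independent
  sum of \<open>n\<close> copies by \<open>m\<close> multiplies the generating function by \<open>pgf q\<close>.
\<close>

lemma pgf_power_is_pgf:
  "\<exists>r. \<forall>z. norm z \<le> 1 \<longrightarrow> pgf r z = pgf q z ^ n"
proof (induction n)
  case 0
  then show ?case by (auto intro: exI[of _ "return_pmf 0"] simp: pgf_return_0)
next
  case (Suc n)
  then obtain r where r: "\<And>z. norm z \<le> 1 \<Longrightarrow> pgf r z = pgf q z ^ n" by blast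
  have "pgf (bind_pmf q (\<lambda>m. map_pmf ((+) m) r)) z = pgf q z ^ Suc n" if "norm z \<le> 1" for z
    by (simp add: pgf_bind pgf_map_add that r) (simp add: pgf_def)
  then show ?case by blast
qed

text \<open>
  Mixing the \<open>N\<close>-fold sums of \<open>q\<close> over a Poisson variable \<open>N\<close> of mean \<open>l\<close> gives the expectation of
  \<open>pgf q z ^ N\<close>, that is, the Poisson generating function \<open>w \<mapsto> exp (l * (w - 1))\<close> at \<open>w = pgf q z\<close>.
\<close>

lemma compound_poisson_pgf:
  assumes "0 \<le> l"
  shows "\<exists>p. \<forall>z. norm z \<le> 1 \<longrightarrow> pgf p z = exp (of_real l * (pgf q z - 1))"
proof (cases "l = 0")
  \<comment> \<open>Poisson laws are defined for positive mean only.\<close>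
  case True
  then show ?thesis by (auto intro: exI[of _ "return_pmf 0"] simp: pgf_return_0)
next
  case False
  with assms have l: "0 < l" by simp
  have "\<forall>n. \<exists>r. \<forall>z. norm z \<le> 1 \<longrightarrow> pgf r z = pgf q z ^ n"
    using pgf_power_is_pgf by blast
  then obtain R where R: "\<And>n z. norm z \<le> 1 \<Longrightarrow> pgf (R n) z = pgf q z ^ n"
    by metis
  have "pgf (bind_pmf (poisson_pmf l) R) z = exp (of_real l * (pgf q z - 1))"
    if z: "norm z \<le> 1" for z
  proof -
    define w where "w = pgf q z"
    have w: "norm w \<le> 1" unfolding w_def using z by (rule norm_pgf_le_1)
    have "(\<lambda>k. (of_real l * w) ^ k /\<^sub>R fact k) sums exp (of_real l * w)"
      by (rule exp_converges)
    then have "(\<lambda>k. of_real (exp (- l)) * ((of_real l * w) ^ k /\<^sub>R fact k))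
        sums (of_real (exp (- l)) * exp (of_real l * w))"
      by (rule sums_mult)
    moreover have "of_real (exp (- l)) * ((of_real l * w) ^ k /\<^sub>R fact k)
        = of_real (pmf (poisson_pmf l) k) * w ^ k" for k
      by (simp add: l power_mult_distrib scaleR_conv_of_real divide_inverse mult_ac)
    moreover have "of_real (exp (- l)) * exp (of_real l * w) = exp (of_real l * (w - 1))"
      by (simp add: exp_of_real exp_diff exp_minus right_diff_distrib divide_inverse flip: exp_of_real)
    ultimately have "(\<lambda>k. of_real (pmf (poisson_pmf l) k) * w ^ k) sums exp (of_real l * (w - 1))"
      by simp
    with w have "pgf (poisson_pmf l) w = exp (of_real l * (w - 1))"
      by (rule pgf_eqI)
    then show ?thesis by (simp add: pgf_bind z R w_def) (simp add: pgf_def)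
  qed
  then show ?thesis by blast
qed

section \<open>Power series with nonnegative coefficients on the closed disc\<close>

text \<open>
  On \<open>{0<..<1}\<close> each partial sum without the constant term is dominated by \<open>f x - c 0\<close>, which is
  bounded because \<open>f\<close> is continuous on a compact set. Letting \<open>x\<close> tend to \<open>1\<close> bounds the partial
  sums of the coefficients themselves.
\<close>

lemma summable_nonneg_coeffs:
  fixes c :: "nat \<Rightarrow> real" and f :: "complex \<Rightarrow> complex"
  assumes nonneg: "\<And>k. 1 \<le> k \<Longrightarrow> 0 \<le> c k"
    and cont: "continuous_on (cball 0 1) f"
    and series: "\<And>z. norm z < 1 \<Longrightarrow> (\<lambda>k. of_real (c k) * z ^ k) sums f z"
  shows "summable c"
proof -
  have "compact (f ` cball 0 1)" by (intro compact_continuous_image cont) simp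
  then have "bounded (f ` cball 0 1)" by (rule compact_imp_bounded)
  then obtain M where M: "\<And>z. norm z \<le> 1 \<Longrightarrow> norm (f z) \<le> M"
    by (meson bounded_iff image_eqI mem_cball_0)
  have le: "(\<Sum>k<n. c (Suc k)) \<le> M - c 0" for n
  proof (rule tendsto_upperbound)
    show "((\<lambda>x. \<Sum>k<n. c (Suc k) * x ^ Suc k) \<longlongrightarrow> (\<Sum>k<n. c (Suc k))) (at_left 1)"
      by (auto intro!: tendsto_eq_intros)
    have "(\<Sum>k<n. c (Suc k) * x ^ Suc k) \<le> M - c 0" if x: "0 < x" "x < 1" for x :: real
    proof -
      have "(\<lambda>k. Re (of_real (c k) * of_real x ^ k)) sums Re (f (of_real x))"
        by (intro sums_Re series) (use x in auto)
      then have s: "(\<lambda>k. c k * x ^ k) sums Re (f (of_real x))"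
        by (simp flip: of_real_power of_real_mult)
      have "sum (\<lambda>k. c k * x ^ k) {..<Suc n} \<le> suminf (\<lambda>k. c k * x ^ k)"
        by (rule sum_le_suminf) (use s x nonneg in \<open>auto simp: sums_iff Suc_le_eq\<close>)
      also have "\<dots> \<le> M"
        using s M[of "of_real x"] complex_Re_le_cmod[of "f (of_real x)"] x by (auto simp: sums_iff)
      finally show ?thesis by (simp add: sum.lessThan_Suc_shift del: sum.lessThan_Suc)
    qed
    then show "\<forall>\<^sub>F x in at_left 1. (\<Sum>k<n. c (Suc k) * x ^ Suc k) \<le> M - c 0"
      by (intro eventually_at_leftI[of 0]) auto
  qed simp
  have "summable (\<lambda>k. c (Suc k))"
    by (rule bounded_imp_summable[OF _ le[of "Suc _", unfolded lessThan_Suc_atMost]]) (simp add: nonneg)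
  then show ?thesis by (simp add: summable_Suc_iff)
qed

text \<open>
  Summable coefficients make the series converge uniformly on the closed disc. Its sum is therefore
  continuous there and agrees with \<open>f\<close> on the closure of the open disc.
\<close>

lemma sums_on_closed_disc:
  fixes c :: "nat \<Rightarrow> real" and f :: "complex \<Rightarrow> complex"
  assumes nonneg: "\<And>k. 1 \<le> k \<Longrightarrow> 0 \<le> c k"
    and cont: "continuous_on (cball 0 1) f"
    and series: "\<And>z. norm z < 1 \<Longrightarrow> (\<lambda>k. of_real (c k) * z ^ k) sums f z"
    and z: "norm z \<le> 1"
  shows "(\<lambda>k. of_real (c k) * z ^ k) sums f z"
proof -
  define g where "g = (\<lambda>z::complex. \<Sum>k. of_real (c k) * z ^ k)"
  have "summable c" by (rule summable_nonneg_coeffs) fact+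
  have "summable (\<lambda>k. \<bar>c (Suc k)\<bar>)"
    using \<open>summable c\<close> nonneg by (simp add: summable_Suc_iff)
  then have abs: "summable (\<lambda>k. \<bar>c k\<bar>)" by (subst (asm) summable_Suc_iff)
  have bound: "norm (of_real (c k) * y ^ k) \<le> \<bar>c k\<bar>" if "norm y \<le> 1" for k and y :: complex
    using that by (simp add: norm_mult norm_power power_le_one mult_left_le)
  have "continuous_on (cball 0 1) g"
  proof (rule uniform_limit_theorem)
    show "uniform_limit (cball 0 1) (\<lambda>n z. \<Sum>k<n. of_real (c k) * z ^ k) g sequentially"
      unfolding g_def by (rule Weierstrass_m_test[OF _ abs]) (use bound in auto)
  qed (auto intro!: continuous_intros always_eventually)
  then have diff_cont: "continuous_on (closure (ball 0 1)) (\<lambda>y. f y - g y)"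
    using cont by (simp add: continuous_on_diff)
  have "f y - g y = 0" if "y \<in> ball 0 1" for y
    using that series[of y] by (simp add: g_def sums_iff)
  from continuous_constant_on_closure[OF diff_cont this, of z] have "f z = g z"
    using z by simp
  moreover have "summable (\<lambda>k. of_real (c k) * z ^ k)"
    by (rule summable_comparison_test'[OF abs]) (use bound z in auto)
  ultimately show ?thesis by (simp add: g_def sums_iff)
qed

text \<open>
  Evaluating the series at \<open>1\<close> shows that the coefficients of positive index add up to \<open>- c 0\<close>.
  Unless they all vanish, they can be normalised to the weights of a jump law, and \<open>exp \<circ> f\<close> is the compound Poisson generating
  function with this jump law and rate \<open>- c 0\<close>.
\<close>

lemma exp_power_series_is_pgf:
  fixes c :: "nat \<Rightarrow> real" and f :: "complex \<Rightarrow> complex"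
  assumes nonneg: "\<And>k. 1 \<le> k \<Longrightarrow> 0 \<le> c k"
    and cont: "continuous_on (cball 0 1) f"
    and series: "\<And>z. norm z < 1 \<Longrightarrow> (\<lambda>k. of_real (c k) * z ^ k) sums f z"
    and f1: "f 1 = 0"
  shows "\<exists>p. \<forall>z. norm z \<le> 1 \<longrightarrow> pgf p z = exp (f z)"
proof -
  define d where "d = (\<lambda>k. if k = 0 then 0 else c k)"
  define l where "l = - c 0"
  have closed: "(\<lambda>k. of_real (c k) * z ^ k) sums f z" if "norm z \<le> 1" for z
    using sums_on_closed_disc[OF nonneg cont series that] by simp
  have d_series: "(\<lambda>k. of_real (d k) * z ^ k) sums (f z + of_real l)" if "norm z \<le> 1" for z
  proof -
    have "(\<lambda>k. of_real (c k) * z ^ k - (if k = 0 then of_real (c 0) else 0)) sums (f z - of_real (c 0))"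
      by (intro sums_diff closed that sums_single)
    moreover have "(\<lambda>k. of_real (c k) * z ^ k - (if k = 0 then of_real (c 0) else 0))
        = (\<lambda>k. of_real (d k) * z ^ k)"
      by (auto simp: d_def)
    ultimately show ?thesis by (simp add: l_def)
  qed
  have d_nonneg: "0 \<le> d k" for k by (simp add: d_def nonneg)
  have "(\<lambda>k. complex_of_real (d k)) sums of_real l" using d_series[of 1] f1 by simp
  then have d_sums: "d sums l" by (simp only: sums_of_real_iff)
  then have "0 \<le> l" using d_nonneg by (metis sums_le sums_zero)
  show ?thesis
  proof (cases "l = 0")
    case True
    then have "d k = 0" for k
      using d_sums d_nonneg suminf_eq_zero_iff[of d] by (auto simp: sums_iff)
    then have "f z = 0" if "norm z \<le> 1" for z
      using d_series[OF that] True by (simp add: sums_iff)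
    then show ?thesis by (auto intro: exI[of _ "return_pmf 0"] simp: pgf_return_0)
  next
    case False
    with \<open>0 \<le> l\<close> have l: "0 < l" by simp
    define q where "q = embed_pmf (\<lambda>k. d k / l)"
    have sum1: "(\<lambda>k. d k / l) sums 1" using sums_divide[OF d_sums, of l] l by simp
    have weight_nonneg: "0 \<le> d k / l" for k using d_nonneg[of k] l by simp
    have "(\<integral>\<^sup>+ k. ennreal (d k / l) \<partial>count_space UNIV) = 1"
      unfolding nn_integral_count_space_nat suminf_ennreal_eq[OF weight_nonneg sum1] by simp
    then have pmf_q: "pmf q k = d k / l" for k
      unfolding q_def by (intro pmf_embed_pmf weight_nonneg)
    have "pgf q z = (f z + of_real l) / of_real l" if "norm z \<le> 1" for z
    proof (rule pgf_eqI[OF that])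
      show "(\<lambda>k. of_real (pmf q k) * z ^ k) sums ((f z + of_real l) / of_real l)"
        using sums_divide[OF d_series[OF that], of "of_real l"] by (simp add: pmf_q)
    qed
    then have "of_real l * (pgf q z - 1) = f z" if "norm z \<le> 1" for z
      using that l by (simp add: diff_divide_distrib add_divide_distrib right_diff_distrib)
    then show ?thesis using compound_poisson_pgf[OF \<open>0 \<le> l\<close>, of q] by metis
  qed
qed

section \<open>The exponents of the discrete stable laws\<close>

text \<open>
  The signed coefficients of \<open>(1 - z) powr a\<close> satisfy a recurrence whose factor \<open>(k - a) / (k + 1)\<close>
  is nonnegative as soon as \<open>k \<ge> a\<close>. From there on the sign persists, so for \<open>a < 1\<close> it is decided
  at \<open>k = 1\<close> and for \<open>1 < a \<le> 2\<close> at \<open>k = 2\<close>.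
\<close>

lemma gbinomial_alternating_Suc:
  fixes a :: real
  shows "(- 1) ^ Suc k * (a gchoose Suc k) = (- 1) ^ k * (a gchoose k) * ((of_nat k - a) / of_nat (Suc k))"
proof -
  have "a gchoose Suc k = (a - of_nat k) * (a gchoose k) / of_nat (Suc k)"
    using gbinomial_mult_1[of a k] by (simp add: field_simps del: of_nat_Suc)
  then show ?thesis by (simp only: power_Suc) (simp add: divide_simps algebra_simps)
qed

lemma gbinomial_sign_below_1:
  fixes a :: real
  assumes "0 < a" "a < 1" "1 \<le> k"
  shows "(- 1) ^ k * (a gchoose k) \<le> 0"
  using \<open>1 \<le> k\<close>
proof (induction k rule: nat_induct_at_least)
  case base
  then show ?case using assms by simp
next
  case (Suc k)
  then show ?case unfolding gbinomial_alternating_Suc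
    using assms by (intro mult_nonpos_nonneg[OF Suc.IH] divide_nonneg_nonneg) auto
qed

lemma gbinomial_sign_above_1:
  fixes a :: real
  assumes "1 < a" "a \<le> 2" "2 \<le> k"
  shows "0 \<le> (- 1) ^ k * (a gchoose k)"
  using \<open>2 \<le> k\<close>
proof (induction k rule: nat_induct_at_least)
  case base
  then show ?case using assms by (simp add: numeral_2_eq_2 gbinomial_Suc)
next
  case (Suc k)
  show ?case unfolding gbinomial_alternating_Suc
    by (rule mult_nonneg_nonneg) (use assms Suc in simp_all)
qed

lemma linear_sums:
  "(\<lambda>k. of_real (if k = 0 then - d else if k = 1 then d else 0) * z ^ k) sums ((z - 1) * of_real d)"
  for z :: complex
proof -
  have "(\<lambda>k. (if k = 1 then of_real d * z else 0) - (if k = 0 then of_real d else 0)) sums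
      (of_real d * z - of_real d)"
    by (intro sums_diff sums_single)
  moreover have "(\<lambda>k. (if k = 1 then of_real d * z else 0) - (if k = 0 then of_real d else 0)) =
      (\<lambda>k. of_real (if k = 0 then - d else if k = 1 then d else 0) * z ^ k)"
    by auto
  ultimately show ?thesis by (simp add: algebra_simps)
qed

lemma one_minus_powr_sums:
  fixes z :: complex and a :: real
  assumes "norm z < 1"
  shows "(\<lambda>k. of_real ((- 1) ^ k * (a gchoose k)) * z ^ k) sums (1 - z) powr of_real a"
proof -
  have "(of_real a gchoose k :: complex) = of_real (a gchoose k)" for k
    by (simp add: gbinomial_prod_rev)
  moreover have "(\<lambda>k. (of_real a gchoose k) * (- z) ^ k) sums (1 + - z) powr of_real a"
    using assms by (intro gen_binomial_complex) simp
  ultimately show ?thesis by (simp add: power_minus[of z] mult_ac)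
qed

text \<open>
  The difference of the logarithmic series and its shift. The formula also covers \<open>k = 1\<close>, where
  \<open>1 / real (k - 1) = 0\<close> gives the coefficient \<open>- 1\<close>.
\<close>

lemma one_minus_times_ln_sums:
  fixes z :: complex
  assumes "norm z < 1"
  shows "(\<lambda>k. of_real (if k = 0 then 0 else 1 / real (k - 1) - 1 / real k) * z ^ k)
    sums ((1 - z) * ln (1 - z))"
proof -
  define L where "L = ln (1 - z)"
  have L: "(\<lambda>k. - (z ^ k) / of_nat k) sums L"
    using Ln_series'[of "- z"] assms by (simp add: L_def)
  have "(\<lambda>k. - z * (- (z ^ k) / of_nat k)) sums (- z * L)"
    using L by (rule sums_mult)
  then have "(\<lambda>k. z ^ Suc k / of_nat k) sums (- z * L)" by simp
  then have "(\<lambda>k. if k = 0 then 0 else z ^ k / of_nat (k - 1)) sums (- z * L)"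
    by (subst sums_Suc_iff[symmetric, where f = "\<lambda>k. if k = 0 then 0 else z ^ k / of_nat (k - 1)", simplified]) simp
  from sums_add[OF L this] have
    "(\<lambda>k. - (z ^ k) / of_nat k + (if k = 0 then 0 else z ^ k / of_nat (k - 1))) sums (L + - z * L)" .
  moreover have "(\<lambda>k. - (z ^ k) / of_nat k + (if k = 0 then 0 else z ^ k / of_nat (k - 1))) =
    (\<lambda>k. of_real (if k = 0 then 0 else 1 / real (k - 1) - 1 / real k) * z ^ k)"
    by (auto simp: fun_eq_iff algebra_simps)
  ultimately show ?thesis by (simp add: L_def algebra_simps)
qed

text \<open>
  The imaginary part of the principal logarithm is bounded by \<open>pi\<close>, so the claim reduces to the
  real limit of \<open>x * ln x\<close> at \<open>0\<close>.
\<close>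

lemma tendsto_mult_ln_0: "((\<lambda>w::complex. w * ln w) \<longlongrightarrow> 0) (at 0)"
proof (rule Lim_null_comparison)
  show "\<forall>\<^sub>F w in at (0::complex). norm (w * ln w) \<le> norm w * \<bar>ln (norm w)\<bar> + norm w * pi"
  proof (unfold eventually_at_filter, intro always_eventually allI impI)
    fix w :: complex assume "w \<noteq> 0"
    then have "norm (ln w) \<le> \<bar>Re (ln w)\<bar> + \<bar>Im (ln w)\<bar>" "\<bar>Im (ln w)\<bar> \<le> pi"
      using cmod_le[of "ln w"] mpi_less_Im_Ln[of w] Im_Ln_le_pi[of w] by auto
    with \<open>w \<noteq> 0\<close> have "norm (ln w) \<le> \<bar>ln (norm w)\<bar> + pi" by simp
    then show "norm (w * ln w) \<le> norm w * \<bar>ln (norm w)\<bar> + norm w * pi"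
      by (simp add: norm_mult mult_left_mono flip: distrib_left)
  qed
  have n: "filterlim norm (at_right 0) (at (0::complex))"
    by (auto simp: filterlim_at eventually_at_filter intro!: tendsto_eq_intros)
  have "((\<lambda>x::real. x * \<bar>ln x\<bar> + x * pi) \<longlongrightarrow> 0) (at_right 0)" by real_asymp
  then show "((\<lambda>w::complex. norm w * \<bar>ln (norm w)\<bar> + norm w * pi) \<longlongrightarrow> 0) (at 0)"
    by (rule filterlim_compose[OF _ n])
qed

lemma one_minus_nonpos_Reals:
  fixes z :: complex
  assumes "norm z \<le> 1" "1 - z \<in> \<real>\<^sub>\<le>\<^sub>0"
  shows "z = 1"
  using assms complex_Re_le_cmod[of z]
  by (auto simp: complex_nonpos_Reals_iff complex_eq_iff)

lemma continuous_on_one_minus_times_ln: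
  "continuous_on (cball 0 1) (\<lambda>z::complex. (1 - z) * ln (1 - z))"
proof -
  have "isCont (\<lambda>w::complex. w * ln w) 0" using tendsto_mult_ln_0 by (simp add: isCont_def)
  moreover have "isCont (\<lambda>w::complex. w * ln w) w" if "w \<notin> \<real>\<^sub>\<le>\<^sub>0" for w
    using that by (intro continuous_intros) auto
  ultimately have "isCont (\<lambda>w::complex. w * ln w) (1 - z)" if "norm z \<le> 1" for z
    using one_minus_nonpos_Reals[OF that] by (cases "1 - z \<in> \<real>\<^sub>\<le>\<^sub>0") auto
  then have "continuous_on ((\<lambda>z. 1 - z) ` cball 0 1) (\<lambda>w::complex. w * ln w)"
    by (intro continuous_at_imp_continuous_on) auto
  then show ?thesis
    by (rule continuous_on_compose2) (auto intro: continuous_on_diff)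
qed

lemma continuous_on_one_minus_powr:
  assumes "0 < a"
  shows "continuous_on (cball 0 1) (\<lambda>z::complex. (1 - z) powr of_real a)"
proof (intro continuous_intros)
  show "cball 0 1 \<subseteq> {z::complex. 0 \<le> Re (1 - z) \<or> Im (1 - z) \<noteq> 0}"
  proof
    fix z :: complex assume "z \<in> cball 0 1"
    then show "z \<in> {z. 0 \<le> Re (1 - z) \<or> Im (1 - z) \<noteq> 0}"
      using complex_Re_le_cmod[of z] by auto
  qed
qed (use assms in auto)

section \<open>Existence and infinite divisibility\<close>

lemma discrete_stable_exists:
  assumes "0 < \<alpha>" "\<alpha> \<le> 2" "ds_admissible \<alpha> \<gamma> \<delta>"
  shows "\<exists>p. discrete_stable \<alpha> \<gamma> \<delta> p"
proof (cases "\<alpha> = 1")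
  case False
  define c where "c = (\<lambda>k. (if k = 0 then - \<delta> else if k = 1 then \<delta> else 0)
    + \<gamma> * ((- 1) ^ k * (\<alpha> gchoose k)))"
  have "\<exists>p. \<forall>z. norm z \<le> 1 \<longrightarrow>
    pgf p z = exp ((z - 1) * of_real \<delta> + of_real \<gamma> * (1 - z) powr of_real \<alpha>)"
  proof (rule exp_power_series_is_pgf[of c])
    show "0 \<le> c k" if "1 \<le> k" for k
    proof (cases "k = 1")
      case True
      then show ?thesis using assms by (simp add: c_def ds_admissible_def mult.commute)
    next
      case k: False
      show ?thesis
      proof (cases "\<alpha> < 1")
        case True
        then have "\<gamma> < 0" using assms by (simp add: ds_admissible_def)
        then show ?thesis using gbinomial_sign_below_1[OF assms(1) True that] k that
          by (simp add: c_def mult_nonpos_nonpos)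
      next
        case False
        with \<open>\<alpha> \<noteq> 1\<close> have "1 < \<alpha>" by simp
        moreover from this have "0 < \<gamma>" using assms by (simp add: ds_admissible_def)
        ultimately show ?thesis using gbinomial_sign_above_1[of \<alpha> k] assms(2) k that
          by (simp add: c_def)
      qed
    qed
    show "(\<lambda>k. of_real (c k) * z ^ k) sums
        ((z - 1) * of_real \<delta> + of_real \<gamma> * (1 - z) powr of_real \<alpha>)" if "norm z < 1" for z :: complex
      using sums_add[OF linear_sums[of \<delta> z] sums_mult[OF one_minus_powr_sums[OF that, of \<alpha>], of "of_real \<gamma>"]]
      unfolding c_def of_real_add of_real_mult distrib_right mult.assoc .
  qed (use assms in \<open>auto intro!: continuous_intros continuous_on_one_minus_powr\<close>)
  then show ?thesis using False by (simp add: discrete_stable_def ds_pgf_def)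
next
  case True
  define c where "c = (\<lambda>k. (if k = 0 then - \<delta> else if k = 1 then \<delta> else 0)
    + \<gamma> * (if k = 0 then 0 else 1 / real (k - 1) - 1 / real k))"
  have \<gamma>: "0 \<le> \<gamma>" "\<gamma> \<le> \<delta>" using assms True by (auto simp: ds_admissible_def)
  have "\<exists>p. \<forall>z. norm z \<le> 1 \<longrightarrow>
    pgf p z = exp ((z - 1) * of_real \<delta> + of_real \<gamma> * ((1 - z) * ln (1 - z)))"
  proof (rule exp_power_series_is_pgf[of c])
    show "0 \<le> c k" if "1 \<le> k" for k
    proof (cases "k = 1")
      case True
      then show ?thesis using \<gamma> by (simp add: c_def)
    next
      case False
      with that have "1 / real k \<le> 1 / real (k - 1)" by (intro divide_left_mono) auto
      with False that \<gamma> show ?thesis by (simp add: c_def)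
    qed
    show "(\<lambda>k. of_real (c k) * z ^ k) sums
        ((z - 1) * of_real \<delta> + of_real \<gamma> * ((1 - z) * ln (1 - z)))" if "norm z < 1" for z :: complex
      using sums_add[OF linear_sums[of \<delta> z] sums_mult[OF one_minus_times_ln_sums[OF that], of "of_real \<gamma>"]]
      unfolding c_def of_real_add of_real_mult distrib_right mult.assoc .
  qed (auto intro!: continuous_intros continuous_on_one_minus_times_ln)
  then show ?thesis using True by (simp add: discrete_stable_def ds_pgf_def mult.assoc)
qed

lemma ds_admissible_divide:
  assumes "ds_admissible \<alpha> \<gamma> \<delta>" "1 \<le> n"
  shows "ds_admissible \<alpha> (\<gamma> / real n) (\<delta> / real n)"
  using assms divide_right_mono[of "\<alpha> * \<gamma>" \<delta> "real n"]
  by (auto simp: ds_admissible_def divide_neg_pos)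

lemma ds_pgf_divide_power:
  assumes "1 \<le> n"
  shows "ds_pgf \<alpha> (\<gamma> / real n) (\<delta> / real n) z ^ n = ds_pgf \<alpha> \<gamma> \<delta> z"
proof -
  have scale: "exp (u * of_real (\<delta> / real n) + of_real (\<gamma> / real n) * v) ^ n
      = exp (u * of_real \<delta> + of_real \<gamma> * v)" for u v :: complex
  proof -
    have "of_nat n * (u * of_real (\<delta> / real n) + of_real (\<gamma> / real n) * v)
        = u * of_real \<delta> + of_real \<gamma> * v"
      using assms by (simp add: field_simps)
    then show ?thesis by (metis exp_of_nat_mult)
  qed
  show ?thesis by (simp only: ds_pgf_def mult.assoc if_distrib[of "\<lambda>x. x ^ n"] scale)
qed

theorem corollary4p1p1:
  fixes \<alpha> \<gamma> \<delta> :: real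
  assumes "0 < \<alpha>" and "\<alpha> \<le> 2"
    and "ds_admissible \<alpha> \<gamma> \<delta>"
  shows "(\<exists>p. discrete_stable \<alpha> \<gamma> \<delta> p) \<and>
         (\<forall>p. discrete_stable \<alpha> \<gamma> \<delta> p \<longrightarrow> discretely_infinitely_divisible p)"
proof (intro conjI allI impI)
  show "\<exists>p. discrete_stable \<alpha> \<gamma> \<delta> p" by (rule discrete_stable_exists) fact+
next
  fix p assume p: "discrete_stable \<alpha> \<gamma> \<delta> p"
  show "discretely_infinitely_divisible p"
    unfolding discretely_infinitely_divisible_def
  proof (intro allI impI)
    fix n :: nat assume n: "1 \<le> n"
    let ?H = "ds_pgf \<alpha> (\<gamma> / real n) (\<delta> / real n)"
    have "is_pgf ?H"
      using discrete_stable_exists[OF assms(1,2) ds_admissible_divide[OF assms(3) n]]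
      unfolding is_pgf_def discrete_stable_def by metis
    moreover have "pgf p z = ?H z ^ n" if "norm z \<le> 1" for z
      using p that by (simp add: discrete_stable_def ds_pgf_divide_power[OF n])
    ultimately show "\<exists>H. is_pgf H \<and> (\<forall>z. norm z \<le> 1 \<longrightarrow> pgf p z = H z ^ n)" by blast
  qed
qed

end
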